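(* For any positive integers $\ell$ and $\mu$, the balanced repetition code $C_{\ell\text{-BR}}^{\mu}\subset\{0,1\}^{2\ell\mu}$ is $\ell/4$-dominating.
   Context: Let $C_{\ell\text{-BR}}=\{0^\ell1^\ell,\;1^\ell0^\ell\}\subset\{0,1\}^{2\ell}$ (a block of $\ell$ zeros followed by $\ell$ ones, and the reverse). The balanced repetition code for $\mu$-bit messages, $C_{\ell\text{-BR}}^{\mu}\subset\{0,1\}^{2\ell\mu}$, is obtained by applying $C_{\ell\text{-BR}}$ bit-wise, i.e. it is the set of all concatenations of $\mu$ elements of $C_{\ell\text{-BR}}$. For $c\in\{0,1\}^N$, a vector $e\in\{-1,0,1\}^{2N}$ is called an embedding of $c$ if removing all the $-1$ entries of $e$ yields $c$. For $c,c'\in\{0,1\}^N$ and $\lambda>0$, $c'$ $\lambda$-dominates $c$ if for all embeddings $e$ of $c$ and $e'$ of $c'$ at least one of the following holds: (a) the number of positions $i\in\{1,\dots,2N\}$ for which $e'_i=1$ and $e_i<1$ is at least $\lambda$; or (b) there exists a consecutive sequence of indices $I\subseteq\{1,\dots,2N\}$ such that the set $J=\{i\in I: e'_i>-1\}$ has size $|J|\ge4\lambda$ and contains at least $\lambda$ indices $i\in J$ with $e_i=-1$. A code $C\subseteq\{0,1\}^N$ is $\lambda$-dominating if any two distinct codewords in $C$ $\lambda$-dominate each other. *)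

theory Defs imports Complex_Main begin

text \<open>Words over \<open>{0,1}\<close> and over \<open>{-1,0,1}\<close> are both integer lists, so that
  embeddings and codewords are compared directly. Positions are counted from 0.\<close>

definition binary_words :: "nat \<Rightarrow> int list set" where
  "binary_words N = {c. length c = N \<and> set c \<subseteq> {0, 1}}"

definition is_embedding :: "int list \<Rightarrow> int list \<Rightarrow> bool" where
  "is_embedding e c \<longleftrightarrow>
     length e = 2 * length c \<and> set e \<subseteq> {-1, 0, 1} \<and> filter (\<lambda>x. x \<noteq> -1) e = c"

text \<open>\<open>dominates lam c' c\<close> reads ``\<open>c'\<close> \<open>lam\<close>-dominates \<open>c\<close>''; it is meant for
  \<open>lam > 0\<close> and binary words \<open>c\<close>, \<open>c'\<close> of a common length. A consecutive sequence of indices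
  is an interval \<open>{a..<b}\<close>.\<close>

definition dominates :: "real \<Rightarrow> int list \<Rightarrow> int list \<Rightarrow> bool" where
  "dominates lam c' c \<longleftrightarrow>
     (\<forall>e e'. is_embedding e c \<longrightarrow> is_embedding e' c' \<longrightarrow>
        real (card {i. i < 2 * length c \<and> e' ! i = 1 \<and> e ! i < 1}) \<ge> lam \<or>
        (\<exists>a b. b \<le> 2 * length c \<and>
           (let J = {i \<in> {a..<b}. e' ! i > -1}
            in real (card J) \<ge> 4 * lam \<and> real (card {i \<in> J. e ! i = -1}) \<ge> lam)))"

definition dominating_code :: "nat \<Rightarrow> real \<Rightarrow> int list set \<Rightarrow> bool" where
  "dominating_code N lam C \<longleftrightarrow>
     C \<subseteq> binary_words N \<and> (\<forall>c\<in>C. \<forall>c'\<in>C. c \<noteq> c' \<longrightarrow> dominates lam c' c)"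

definition balanced_block_code :: "nat \<Rightarrow> int list set" where
  "balanced_block_code l =
     {replicate l 0 @ replicate l 1, replicate l 1 @ replicate l 0}"

definition balanced_repetition_code :: "nat \<Rightarrow> nat \<Rightarrow> int list set" where
  "balanced_repetition_code l \<mu> =
     {concat ws | ws. length ws = \<mu> \<and> set ws \<subseteq> balanced_block_code l}"

end

(* For a binary word c let g(c,k) be the number of zeros of c that are preceded by exactly k ones.
   In a codeword both k (for each zero) and g(c,k) are multiples of l.  Two distinct codewords have
   the same number of zeros, so some k satisfies g(c',k) \<ge> g(c,k) + l.  If (a) fails, prefixes of
   e and e' have numbers of ones that differ by less than l; hence a zero of e lying at one of the
   g(c',k) zeros of e' after exactly k ones is itself preceded by exactly k ones.  So at most g(c,k)
   of those positions carry a zero of e and fewer than l/4 carry a one of e, and the remaining ones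
   carry -1, which gives (b). *)

theory Submission imports Defs begin

section \<open>Zeros of a word sorted by the number of ones before them\<close>

text \<open>The g of the overview, defined on all integer lists so that it applies to embeddings as
  well: entries -1 count neither as zeros nor as ones.\<close>

definition zeros_after :: "nat \<Rightarrow> int list \<Rightarrow> nat" where
  "zeros_after k xs = card {i. i < length xs \<and> xs ! i = 0 \<and> count_list (take i xs) 1 = k}"

lemma zeros_after_Nil [simp]: "zeros_after k [] = 0"
  by (simp add: zeros_after_def)

lemma zeros_after_append:
  "zeros_after k (xs @ ys) = zeros_after k xs +
     (if count_list xs 1 \<le> k then zeros_after (k - count_list xs 1) ys else 0)"
proof -
  let ?n = "length xs" and ?m = "count_list xs 1"
  define A where "A = {i. i < ?n \<and> xs ! i = 0 \<and> count_list (take i xs) 1 = k}"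
  define B where "B = {i. i < length ys \<and> ys ! i = 0 \<and> ?m + count_list (take i ys) 1 = k}"
  have "{i. i < length (xs @ ys) \<and> (xs @ ys) ! i = 0 \<and> count_list (take i (xs @ ys)) 1 = k}
      = A \<union> (+) ?n ` B" (is "?S = _")
  proof (rule set_eqI)
    fix i
    show "i \<in> ?S \<longleftrightarrow> i \<in> A \<union> (+) ?n ` B"
    proof (cases "i < ?n")
      case True
      then show ?thesis by (auto simp: A_def nth_append)
    next
      case False
      then obtain j where "i = ?n + j" by (metis le_Suc_ex not_less)
      then show ?thesis by (auto simp: A_def B_def nth_append)
    qed
  qed
  moreover have "card (A \<union> (+) ?n ` B) = card A + card B"
    by (subst card_Un_disjoint) (auto simp: A_def B_def card_image)
  moreover have "card B = (if ?m \<le> k then zeros_after (k - ?m) ys else 0)"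
  proof (cases "?m \<le> k")
    case True
    then have "B = {i. i < length ys \<and> ys ! i = 0 \<and> count_list (take i ys) 1 = k - ?m}"
      by (auto simp: B_def)
    then show ?thesis using True by (simp add: zeros_after_def)
  qed (auto simp: B_def)
  ultimately show ?thesis by (simp add: zeros_after_def A_def)
qed

lemma zeros_after_singleton: "zeros_after k [x] = (if x = 0 \<and> k = 0 then 1 else 0)"
proof -
  have "{i. i < length [x] \<and> [x] ! i = 0 \<and> count_list (take i [x]) 1 = k}
      = (if x = 0 \<and> k = 0 then {0} else {})" by auto
  then show ?thesis by (simp add: zeros_after_def)
qed

lemma zeros_after_Cons:
  "zeros_after k (x # xs) =
     (if x = 1 then (if k = 0 then 0 else zeros_after (k - 1) xs)
      else (if x = 0 \<and> k = 0 then 1 else 0) + zeros_after k xs)"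
  using zeros_after_append[of k "[x]" xs] by (auto simp: zeros_after_singleton)

text \<open>Transfers the statistic between a codeword and any of its embeddings.\<close>

lemma zeros_after_filter: "zeros_after k (filter (\<lambda>x. x \<noteq> -1) xs) = zeros_after k xs"
  by (induction xs arbitrary: k) (auto simp: zeros_after_Cons)

lemma zeros_after_replicate_0: "zeros_after k (replicate n 0) = (if k = 0 then n else 0)"
  by (induction n) (auto simp: zeros_after_Cons)

lemma zeros_after_replicate_1: "zeros_after k (replicate n 1) = 0"
  by (induction n arbitrary: k) (auto simp: zeros_after_Cons)

lemma count_list_replicate: "count_list (replicate n x) y = (if x = y then n else 0)"
  by (induction n) auto

text \<open>Every zero has between 0 and \<open>count_list xs 1\<close> ones before it, so it is
  counted for exactly one \<open>k\<close> of the range.\<close>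

lemma sum_zeros_after: "(\<Sum>k\<le>count_list xs 1. zeros_after k xs) = count_list xs 0"
proof (induction xs)
  case (Cons x xs)
  show ?case
  proof (cases "x = 1")
    case True
    then show ?thesis using Cons by (simp add: zeros_after_Cons sum.atMost_Suc_shift del: sum.atMost_Suc)
  next
    case False
    then show ?thesis using Cons by (auto simp: zeros_after_Cons sum.distrib)
  qed
qed simp

text \<open>A binary word with m ones is a sequence of m + 1 possibly empty runs of zeros separated
  by single ones, and the values of \<open>zeros_after\<close> are the run lengths. The number of
  ones must be given too, since trailing ones precede no zero.\<close>

lemma zeros_after_inject:
  assumes "set xs \<subseteq> {0, 1}" "set ys \<subseteq> {0, 1}" "count_list xs 1 = count_list ys 1"
    and "\<And>k. zeros_after k xs = zeros_after k ys"
  shows "xs = ys"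
  using assms
proof (induction xs arbitrary: ys)
  case Nil
  show ?case
  proof (cases ys)
    case (Cons y ys')
    with Nil.prems(2,3) Nil.prems(4)[of 0] show ?thesis by (auto simp: zeros_after_Cons split: if_splits)
  qed simp
next
  case (Cons x xs)
  obtain y ys' where ys: "ys = y # ys'"
    using Cons.prems(1,3) Cons.prems(4)[of 0]
    by (cases ys) (auto simp: zeros_after_Cons split: if_splits)
  have xy: "x = y"
    using Cons.prems(1,2) Cons.prems(4)[of 0]
    by (auto simp: ys zeros_after_Cons split: if_splits)
  \<comment> \<open>A leading 1 shifts the index by one, so that case uses the instance
    \<open>Suc k\<close>; a leading 0 uses the instance \<open>k\<close>.\<close>
  have "zeros_after k xs = zeros_after k ys'" for k
    using Cons.prems(1) Cons.prems(4)[of k] Cons.prems(4)[of "Suc k"]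
    by (auto simp: ys xy zeros_after_Cons split: if_splits)
  then have "xs = ys'"
    using Cons.prems(1-3) by (intro Cons.IH) (auto simp: ys xy split: if_splits)
  then show ?case by (simp add: ys xy)
qed

lemma count_list_take_eq_card:
  assumes "i \<le> length xs"
  shows "count_list (take i xs) x = card {j. j < i \<and> xs ! j = x}"
proof -
  have "{j. j < length (take i xs) \<and> x = take i xs ! j} = {j. j < i \<and> xs ! j = x}"
    using assms by auto
  then show ?thesis by (simp add: count_list_eq_length_filter length_filter_conv_card)
qed

section \<open>Divisibility by \<open>l\<close> in codewords\<close>

text \<open>The \<open>l\<close> zeros of a block form one run, which comes after 0 or after
  \<open>l\<close> ones.\<close>

lemma balanced_block_code_props:
  assumes "w \<in> balanced_block_code l"
  shows "length w = 2 * l" "set w \<subseteq> {0, 1}" "count_list w 1 = l" "count_list w 0 = l"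
    "l dvd zeros_after k w" "zeros_after k w > 0 \<Longrightarrow> l dvd k"
  using assms
  by (auto simp: balanced_block_code_def count_list_replicate zeros_after_append
      zeros_after_replicate_0 zeros_after_replicate_1 split: if_splits)

text \<open>Each block contributes exactly \<open>l\<close> ones, so prepending one shifts the
  indices of the later zeros by \<open>l\<close> and preserves divisibility.\<close>

lemma concat_balanced_blocks_props:
  assumes "set ws \<subseteq> balanced_block_code l"
  shows "length (concat ws) = 2 * l * length ws" "set (concat ws) \<subseteq> {0, 1}"
    "count_list (concat ws) 1 = l * length ws" "count_list (concat ws) 0 = l * length ws"
    "l dvd zeros_after k (concat ws)" "zeros_after k (concat ws) > 0 \<Longrightarrow> l dvd k"
proof -
  show "length (concat ws) = 2 * l * length ws"
    using assms by (induction ws) (auto simp: balanced_block_code_props)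
  show "set (concat ws) \<subseteq> {0, 1}"
    using assms balanced_block_code_props(2) by fastforce
  show "count_list (concat ws) 1 = l * length ws"
    using assms by (induction ws) (auto simp: balanced_block_code_props)
  show "count_list (concat ws) 0 = l * length ws"
    using assms by (induction ws) (auto simp: balanced_block_code_props)
  show "l dvd zeros_after k (concat ws)"
    using assms
    by (induction ws arbitrary: k) (auto simp: zeros_after_append balanced_block_code_props)
  show "l dvd k" if "zeros_after k (concat ws) > 0"
    using assms that
  proof (induction ws arbitrary: k)
    case (Cons w ws)
    then show ?case
      by (auto simp: zeros_after_append balanced_block_code_props split: if_splits)
        (metis dvd_diffD dvd_refl)+
  qed simp
qed

lemma balanced_repetition_code_props:
  assumes "c \<in> balanced_repetition_code l \<mu>"
  shows "length c = 2 * l * \<mu>" "set c \<subseteq> {0, 1}"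
    "count_list c 1 = l * \<mu>" "count_list c 0 = l * \<mu>"
    "l dvd zeros_after k c" "zeros_after k c > 0 \<Longrightarrow> l dvd k"
proof -
  obtain ws where ws: "c = concat ws" "length ws = \<mu>" "set ws \<subseteq> balanced_block_code l"
    using assms unfolding balanced_repetition_code_def by blast
  note P = concat_balanced_blocks_props[OF ws(3), folded ws(1), unfolded ws(2)]
  show "length c = 2 * l * \<mu>" "set c \<subseteq> {0, 1}"
    "count_list c 1 = l * \<mu>" "count_list c 0 = l * \<mu>"
    "l dvd zeros_after k c" "zeros_after k c > 0 \<Longrightarrow> l dvd k"
    by (fact P)+
qed

section \<open>Comparison of two codewords and of their embeddings\<close>

text \<open>If no value were larger for \<open>c'\<close>, the equal sums over \<open>k\<close>
  would force equality everywhere and hence \<open>c = c'\<close>. A strict inequality between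
  multiples of \<open>l\<close> is a gap of at least \<open>l\<close>.\<close>

lemma exists_zeros_after_gap:
  assumes c: "c \<in> balanced_repetition_code l \<mu>" and c': "c' \<in> balanced_repetition_code l \<mu>"
    and "c \<noteq> c'"
  obtains k where "zeros_after k c + l \<le> zeros_after k c'"
proof -
  note C = balanced_repetition_code_props[OF c] and C' = balanced_repetition_code_props[OF c']
  have cnt: "count_list c 1 = l * \<mu>" "count_list c' 1 = l * \<mu>"
    "count_list c 0 = l * \<mu>" "count_list c' 0 = l * \<mu>"
    and bin: "set c \<subseteq> {0, 1}" "set c' \<subseteq> {0, 1}"
    by (fact C C')+
  have "\<exists>k. zeros_after k c < zeros_after k c'"
  proof (rule ccontr)
    assume "\<nexists>k. zeros_after k c < zeros_after k c'"
    then have le: "zeros_after k c' \<le> zeros_after k c" for k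
      by (meson not_less)
    have beyond: "zeros_after k xs = 0" if "k > count_list xs 1" for k and xs :: "int list"
    proof -
      have "count_list (take i xs) 1 \<le> count_list xs 1" for i
        by (metis append_take_drop_id count_list_append le_add1)
      then show ?thesis
        using that by (auto simp: zeros_after_def card_eq_0_iff leD)
    qed
    have "zeros_after k c' = zeros_after k c" for k
    proof (cases "k \<le> l * \<mu>")
      case True
      show ?thesis
        by (rule sum_mono_inv[of "\<lambda>k. zeros_after k c'" "{..l * \<mu>}"])
          (use True le cnt sum_zeros_after[of c] sum_zeros_after[of c'] in auto)
    qed (use beyond cnt in simp)
    then have "c' = c"
      by (intro zeros_after_inject) (use cnt bin in auto)
    with \<open>c \<noteq> c'\<close> show False by simp
  qed
  then obtain k where k: "zeros_after k c < zeros_after k c'" by blast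
  have "l dvd zeros_after k c' - zeros_after k c"
    using C(5) C'(5) by (rule dvd_diff_nat[rotated])
  with k have "l \<le> zeros_after k c' - zeros_after k c"
    by (intro dvd_imp_le) auto
  with k that[of k] show thesis by simp
qed

lemma balanced_repetition_code_dominates:
  assumes "l > 0" and c: "c \<in> balanced_repetition_code l \<mu>"
    and c': "c' \<in> balanced_repetition_code l \<mu>" and "c \<noteq> c'"
  shows "dominates (real l / 4) c' c"
  unfolding dominates_def
proof (intro allI impI)
  fix e e' assume e: "is_embedding e c" and e': "is_embedding e' c'"
  define n where "n = 2 * length c"
  define D where "D = {i. i < n \<and> e' ! i = 1 \<and> e ! i < 1}"
  \<comment> \<open>\<open>D\<close> is the set counted in alternative (a) and \<open>E\<close> is
    its mirror image. Both embeddings contain \<open>l * \<mu>\<close> ones, so the two sets have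
    the same size and a bound on \<open>D\<close> also bounds \<open>E\<close>.\<close>
  define E where "E = {i. i < n \<and> e ! i = 1 \<and> e' ! i \<noteq> 1}"
  define ones where "ones = (\<lambda>xs i. count_list (take i xs) (1::int))"
  note C = balanced_repetition_code_props[OF c] and C' = balanced_repetition_code_props[OF c']
  have len: "length e = n" "length e' = n"
    using e e' C(1) C'(1) by (auto simp: is_embedding_def n_def)
  have range: "e ! i \<in> {-1, 0, 1}" "e' ! i \<in> {-1, 0, 1}" if "i < n" for i
  proof -
    have "set e \<subseteq> {-1, 0, 1}" "set e' \<subseteq> {-1, 0, 1}"
      using e e' by (simp_all add: is_embedding_def)
    then show "e ! i \<in> {-1, 0, 1}" "e' ! i \<in> {-1, 0, 1}"
      using that len by (metis nth_mem subsetD)+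
  qed
  have g: "zeros_after k e = zeros_after k c" "zeros_after k e' = zeros_after k c'" for k
    using e e' zeros_after_filter[of k e] zeros_after_filter[of k e']
    by (simp_all add: is_embedding_def)
  have ones_card: "ones e i = card {j. j < i \<and> e ! j = 1}"
    "ones e' i = card {j. j < i \<and> e' ! j = 1}" if "i \<le> n" for i
    using that len by (simp_all add: ones_def count_list_take_eq_card)
  have count_filter: "count_list (filter (\<lambda>x. x \<noteq> -1) xs) 1 = count_list xs 1" for xs :: "int list"
    by (induction xs) auto
  have "count_list e 1 = count_list e' 1"
    using e e' C(3) C'(3) count_filter[of e] count_filter[of e'] by (simp add: is_embedding_def)
  then have total: "card {j. j < n \<and> e ! j = 1} = card {j. j < n \<and> e' ! j = 1}"
    using ones_card[of n] len by (simp add: ones_def)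
  have fin: "finite D" "finite E" by (auto simp: D_def E_def)
  have D_eq: "D = {j. j < n \<and> e' ! j = 1} - {j. j < n \<and> e ! j = 1}"
    using range(1) by (force simp: D_def)
  have E_eq: "E = {j. j < n \<and> e ! j = 1} - {j. j < n \<and> e' ! j = 1}"
    by (auto simp: E_def)
  have card_E: "card E = card D"
    using total by (simp add: D_eq E_eq card_Diff_subset_Int Int_commute)
  have "real (card D) \<ge> real l / 4 \<or>
        (\<exists>a b. b \<le> n \<and>
           (let J = {i \<in> {a..<b}. e' ! i > -1}
            in real (card J) \<ge> 4 * (real l / 4) \<and> real (card {i \<in> J. e ! i = -1}) \<ge> real l / 4))"
  proof (cases "real (card D) \<ge> real l / 4")
    case False
    obtain k where k: "zeros_after k c + l \<le> zeros_after k c'"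
      using exists_zeros_after_gap[OF c c' \<open>c \<noteq> c'\<close>] .
    have l_dvd_k: "l dvd k" using k \<open>l > 0\<close> by (intro C'(6)) simp
    define A where "A = {i. i < n \<and> e' ! i = 0 \<and> ones e' i = k}"
    have card_A: "card A = zeros_after k c'"
      using g by (simp add: A_def zeros_after_def ones_def len)
    have finA: "finite A" by (simp add: A_def)
    have "A \<noteq> {}" using card_A k \<open>l > 0\<close> by auto
    \<comment> \<open>The shortest interval containing \<open>A\<close>; \<open>Suc\<close> because
      its right end is excluded. With threshold \<open>l / 4\<close>, alternative (b) asks for
      \<open>l\<close> indices in \<open>J\<close>, and \<open>A\<close> alone supplies
      them.\<close>
    define a b where "a = Min A" and "b = Suc (Max A)"
    have "b \<le> n" using Max_in[OF finA \<open>A \<noteq> {}\<close>] by (auto simp: b_def A_def)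
    define J where "J = {i \<in> {a..<b}. e' ! i > -1}"
    define B where "B = {i \<in> J. e ! i = -1}"
    define G where "G = {i. i < n \<and> e ! i = 0 \<and> ones e i = k}"
    have finJ: "finite J" and finG: "finite G" and finB: "finite B"
      by (auto simp: J_def G_def B_def)
    have "A \<subseteq> J"
      using finA by (auto simp: J_def a_def b_def less_Suc_eq_le A_def)
    have card_J: "card J \<ge> l"
      using card_mono[OF finJ \<open>A \<subseteq> J\<close>] card_A k by linarith
    have card_G: "card G = zeros_after k c"
      using g by (simp add: G_def zeros_after_def ones_def len)
    \<comment> \<open>Within a prefix, ones of \<open>e'\<close> not matched by \<open>e\<close> lie
      in \<open>D\<close>, and ones of \<open>e\<close> not matched by \<open>e'\<close> lie in
      \<open>E\<close>.\<close>
    have ones_le: "ones e' i \<le> ones e i + card D" "ones e i \<le> ones e' i + card D"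
      if "i < n" for i
    proof -
      have "card {j. j < i \<and> e' ! j = 1} \<le> card ({j. j < i \<and> e ! j = 1} \<union> D)"
        using that fin by (intro card_mono) (auto simp: D_eq)
      also have "\<dots> \<le> card {j. j < i \<and> e ! j = 1} + card D" by (rule card_Un_le)
      finally show "ones e' i \<le> ones e i + card D" using ones_card that by simp
      have "card {j. j < i \<and> e ! j = 1} \<le> card ({j. j < i \<and> e' ! j = 1} \<union> E)"
        using that fin by (intro card_mono) (auto simp: E_def)
      also have "\<dots> \<le> card {j. j < i \<and> e' ! j = 1} + card E" by (rule card_Un_le)
      finally show "ones e i \<le> ones e' i + card D" using ones_card that card_E by simp
    qed
    have "i \<in> G" if "i \<in> A" "e ! i = 0" for i
    proof -
      have i: "i < n" "ones e' i = k" using that by (auto simp: A_def)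
      \<comment> \<open>Position \<open>i\<close> is itself such a zero, so the divisibility known
        for the zeros of \<open>c\<close> applies to \<open>ones e i\<close>.\<close>
      have "zeros_after (ones e i) e > 0"
        using i that len by (auto simp: zeros_after_def ones_def card_gt_0_iff)
      then have "l dvd ones e i" using g(1) C(6) by simp
      \<comment> \<open>The two truncated differences together replace the absolute value: both are
        multiples of \<open>l\<close> below \<open>l\<close>, hence 0.\<close>
      then have dvd: "l dvd ones e i - k" "l dvd k - ones e i"
        using l_dvd_k by (auto intro: dvd_diff_nat)
      have "card D < l" using False by linarith
      then have "ones e i - k < l" "k - ones e i < l"
        using ones_le[OF i(1)] i(2) by linarith+
      then have "ones e i - k = 0" "k - ones e i = 0"
        using dvd nat_dvd_not_less by blast+
      then have "ones e i = k" by simp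
      then show ?thesis using i that by (simp add: G_def)
    qed
    \<comment> \<open>On \<open>A\<close> the entry of \<open>e'\<close> is 0. An entry 0 of
      \<open>e\<close> puts the position in \<open>G\<close>, an entry 1 in \<open>E\<close>, an
      entry -1 in \<open>B\<close>.\<close>
    then have "A \<subseteq> G \<union> E \<union> B"
      using \<open>A \<subseteq> J\<close> range by (fastforce simp: A_def E_def B_def)
    then have "card A \<le> card (G \<union> E \<union> B)"
      using finG fin finB by (intro card_mono) auto
    also have "\<dots> \<le> card G + card E + card B"
      using card_Un_le[of "G \<union> E" B] card_Un_le[of G E] by linarith
    \<comment> \<open>\<open>A\<close> exceeds \<open>G\<close> by at least \<open>l\<close> and
      \<open>E\<close> has fewer than \<open>l / 4\<close> elements, so more than
      \<open>3 * l / 4\<close> positions remain for \<open>B\<close>.\<close>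
    finally have "real l / 4 \<le> real (card B)"
      using False k card_A card_G card_E by linarith
    with card_J \<open>b \<le> n\<close> show ?thesis
      unfolding B_def J_def Let_def by (intro disjI2 exI[of _ a] exI[of _ b]) simp
  qed simp
  then show "real l / 4 \<le> real (card {i. i < 2 * length c \<and> e' ! i = 1 \<and> e ! i < 1}) \<or>
        (\<exists>a b. b \<le> 2 * length c \<and>
           (let J = {i \<in> {a..<b}. e' ! i > -1}
            in real (card J) \<ge> 4 * (real l / 4) \<and> real (card {i \<in> J. e ! i = -1}) \<ge> real l / 4))"
    unfolding D_def n_def .
qed

theorem lemma7p6:
  fixes l \<mu> :: nat
  assumes "l > 0" and "\<mu> > 0"
  shows "dominating_code (2 * l * \<mu>) (real l / 4) (balanced_repetition_code l \<mu>)"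
  unfolding dominating_code_def
proof (intro conjI ballI impI subsetI)
  fix c assume "c \<in> balanced_repetition_code l \<mu>"
  then show "c \<in> binary_words (2 * l * \<mu>)"
    by (simp add: binary_words_def balanced_repetition_code_props)
qed (use assms balanced_repetition_code_dominates in blast)

end
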